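(* Let $F_k:\mathbb{R}^n\to\mathcal{I}$ ($k\in K:=\{1,\dots,m\}$) and $g_j:\mathbb{R}^n\to\mathbb{R}$ ($j\in J:=\{1,\dots,p\}$) be locally Lipschitz continuous, $F=(F_1,\dots,F_m)$, $S:=\{u\in\mathbb{R}^n:g_j(u)\le0,\ \forall j\in J\}$. Let $\overline{u}\in M(F,S)$ and assume that BCQ holds at $\overline{u}\in S$. Then there exist $\lambda\in\mathbb{R}^m_+$ with $\sum_{k\in K}\lambda_k=1$ and $\mu\in\mathbb{R}^p_+$ such that $$0\in\sum_{k\in K}\lambda_k\partial^0 F_k(\overline{u})+\sum_{j\in I(\overline{u})}\mu_j\partial^0 g_j(\overline{u}),\qquad \mu_jg_j(\overline{u})=0\ \ \forall j\in J.$$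
   Context: $\mathcal{I}$ is the set of all compact intervals $[\underline q,\overline q]$ with $\underline q\le\overline q$ real. For $Q=[\underline q,\overline q]\in\mathcal I$ put $q^c=\frac{\underline q+\overline q}{2}$ and $q^w=\frac{\overline q-\underline q}{2}$. Order: $Q\prec_{CW}R$ iff $q^c<r^c$ and $q^w<r^w$. $\mathbb{R}^m_+$ is the nonnegative orthant; $\mathrm{co}$ denotes convex hull. An interval-valued function $f=[\underline f,\overline f]:\mathbb{R}^n\to\mathcal I$ is locally Lipschitz continuous if every point has a neighbourhood $U$ and $L>0$ with $\max\{|\underline f(u_1)-\underline f(u_2)|,|\overline f(u_1)-\overline f(u_2)|\}\le L\|u_1-u_2\|$ for $u_1,u_2\in U$ (equivalently, $\underline f,\overline f$ are locally Lipschitz). Write $f^c=\frac{\underline f+\overline f}{2}$, $f^w=\frac{\overline f-\underline f}{2}$. For locally Lipschitz $\psi:\mathbb{R}^n\to\mathbb{R}$, $\psi^0(z;w)=\limsup_{u\to z,\,t\to0^+}\frac{\psi(u+tw)-\psi(u)}{t}$ and $\partial^0\psi(z)=\{z^*\in\mathbb{R}^n:\langle z^*,w\rangle\le\psi^0(z;w)\ \forall w\}$ (Clarke gradient). For a locally Lipschitz interval-valued $f$, the weakly generalized gradient is $\partial^0f(u):=\mathrm{co}(\partial^0f^c(u)\cup\partial^0f^w(u))$. $M(F,S)$ (weak minimal solutions) is the set of $z_0\in S$ for which there is no $z\in S$ with $F_k(z)\prec_{CW}F_k(z_0)$ for all $k\in K$. For $u\in S$, $I(u):=\{j\in J:g_j(u)=0\}$.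 BCQ holds at $u\in S$ if there is no $\mu\in\mathbb{R}^p_+\setminus\{0\}$ with $\mu_j\ge 0$ for $j\in I(u)$, $\mu_j=0$ for $j\notin I(u)$ and $0\in\sum_{j\in J}\mu_j\partial^0g_j(u)$. A sum over an empty index set is $\{0\}$. *)

theory Defs
  imports
    "HOL-Analysis.Analysis"
    "HOL-Library.Interval"
    "HOL-Library.Set_Algebras"
begin

text \<open>Half-width, not the library's width, which is the full length of the interval.\<close>

definition center :: "real interval \<Rightarrow> real" where
  "center Q = (lower Q + upper Q) / 2"

definition halfwidth :: "real interval \<Rightarrow> real" where
  "halfwidth Q = (upper Q - lower Q) / 2"

text \<open>The center-width order is unrelated to the library's order on intervals,
  which is inclusion.\<close>

definition prec_CW :: "real interval \<Rightarrow> real interval \<Rightarrow> bool"  (infix \<open>\<prec>\<^sub>C\<^sub>W\<close> 50) where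
  "Q \<prec>\<^sub>C\<^sub>W R \<longleftrightarrow> center Q < center R \<and> halfwidth Q < halfwidth R"

definition loc_lipschitz :: "(real ^ 'n \<Rightarrow> real) \<Rightarrow> bool" where
  "loc_lipschitz \<psi> \<longleftrightarrow> (\<forall>u. \<exists>U L. open U \<and> u \<in> U \<and> L > 0 \<and>
     (\<forall>u1\<in>U. \<forall>u2\<in>U. \<bar>\<psi> u1 - \<psi> u2\<bar> \<le> L * norm (u1 - u2)))"

definition iv_loc_lipschitz :: "(real ^ 'n \<Rightarrow> real interval) \<Rightarrow> bool" where
  "iv_loc_lipschitz f \<longleftrightarrow> (\<forall>u. \<exists>U L. open U \<and> u \<in> U \<and> L > 0 \<and>
     (\<forall>u1\<in>U. \<forall>u2\<in>U.
        max \<bar>lower (f u1) - lower (f u2)\<bar> \<bar>upper (f u1) - upper (f u2)\<bar> \<le> L * norm (u1 - u2)))"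

text \<open>The upper limit is taken in the extended reals, where it always exists; it is finite when
  \<open>\<psi>\<close> is locally Lipschitz. The base point may equal \<open>z\<close>, hence \<open>nhds z\<close> and not \<open>at z\<close>.\<close>

definition clarke_dd :: "(real ^ 'n \<Rightarrow> real) \<Rightarrow> real ^ 'n \<Rightarrow> real ^ 'n \<Rightarrow> ereal" where
  "clarke_dd \<psi> z w =
     Limsup (nhds z \<times>\<^sub>F at_right 0) (\<lambda>(u, t). ereal ((\<psi> (u + t *\<^sub>R w) - \<psi> u) / t))"

definition clarke_grad :: "(real ^ 'n \<Rightarrow> real) \<Rightarrow> real ^ 'n \<Rightarrow> (real ^ 'n) set" where
  "clarke_grad \<psi> z = {z'. \<forall>w. ereal (z' \<bullet> w) \<le> clarke_dd \<psi> z w}"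

definition weak_gen_grad :: "(real ^ 'n \<Rightarrow> real interval) \<Rightarrow> real ^ 'n \<Rightarrow> (real ^ 'n) set" where
  "weak_gen_grad f u =
     convex hull (clarke_grad (\<lambda>x. center (f x)) u \<union> clarke_grad (\<lambda>x. halfwidth (f x)) u)"

text \<open>Families indexed by \<open>1, \<dots>, m\<close> (resp. \<open>p\<close>), and coordinate vectors of length \<open>m\<close>
  (resp. \<open>p\<close>), are functions on \<open>nat\<close> whose values outside
  \<open>{1..m}\<close> (resp. \<open>{1..p}\<close>) are irrelevant.\<close>

definition nonneg_orthant :: "nat \<Rightarrow> (nat \<Rightarrow> real) set" where
  "nonneg_orthant d = {x. \<forall>i\<in>{1..d}. 0 \<le> x i}"

definition feasible_set :: "nat \<Rightarrow> (nat \<Rightarrow> real ^ 'n \<Rightarrow> real) \<Rightarrow> (real ^ 'n) set" where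
  "feasible_set p g = {u. \<forall>j\<in>{1..p}. g j u \<le> 0}"

definition weak_minimal ::
    "nat \<Rightarrow> (nat \<Rightarrow> real ^ 'n \<Rightarrow> real interval) \<Rightarrow> (real ^ 'n) set \<Rightarrow> (real ^ 'n) set" where
  "weak_minimal m F S = {z0 \<in> S. \<not> (\<exists>z\<in>S. \<forall>k\<in>{1..m}. F k z \<prec>\<^sub>C\<^sub>W F k z0)}"

definition active :: "nat \<Rightarrow> (nat \<Rightarrow> real ^ 'n \<Rightarrow> real) \<Rightarrow> real ^ 'n \<Rightarrow> nat set" where
  "active p g u = {j \<in> {1..p}. g j u = 0}"

text \<open>Sums of sets are Minkowski sums from \<open>Set_Algebras\<close>; the empty sum is \<open>{0}\<close>.\<close>

definition BCQ :: "nat \<Rightarrow> (nat \<Rightarrow> real ^ 'n \<Rightarrow> real) \<Rightarrow> real ^ 'n \<Rightarrow> bool" where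
  "BCQ p g u \<longleftrightarrow>
     \<not> (\<exists>\<mu>\<in>nonneg_orthant p. (\<exists>j\<in>{1..p}. \<mu> j \<noteq> 0) \<and>
          (\<forall>j\<in>active p g u. 0 \<le> \<mu> j) \<and> (\<forall>j\<in>{1..p} - active p g u. \<mu> j = 0) \<and>
          0 \<in> (\<Sum>j\<in>{1..p}. (*\<^sub>R) (\<mu> j) ` clarke_grad (g j) u))"

end

theory Submission
  imports Defs
begin

text \<open>Weak minimality of \<open>ubar\<close> says that the maximum of the functions
  \<open>F\<^sub>k\<^sup>c - F\<^sub>k\<^sup>c(ubar)\<close>, \<open>F\<^sub>k\<^sup>w - F\<^sub>k\<^sup>w(ubar)\<close>, \<open>g\<^sub>j\<close> is nowhere negative. If \<open>0\<close> were not in the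
  convex hull of the Clarke gradients of those functions that vanish at \<open>ubar\<close>, it could be strictly
  separated from this compact set by a direction \<open>w\<close>. The generalized derivative is the support
  function of the Clarke gradient (separate points from its closed epigraph), so all these
  generalized derivatives would be negative at \<open>w\<close>, and a short step along \<open>w\<close> would make the
  maximum negative. BCQ excludes that the resulting convex combination only involves the
  constraints, so it can be rescaled.\<close>

section \<open>Generalized directional derivative: bounds and sublinearity\<close>

text \<open>Eventual bounds on difference quotients carry over to moved base points and rescaled
  steps: a shift \<open>v\<close> with \<open>c = 1\<close> serves subadditivity, a factor
  \<open>c\<close> with \<open>v = 0\<close> serves positive homogeneity.\<close>

lemma filterlim_clarke_base:
  fixes z :: "real ^ 'n"
  assumes "c > 0"
  shows "filterlim (\<lambda>x. (fst x + snd x *\<^sub>R v, c * snd x)) (nhds z \<times>\<^sub>F at_right 0) (nhds z \<times>\<^sub>F at_right (0::real))"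
proof -
  have t0: "((\<lambda>x. snd x) \<longlongrightarrow> 0) (nhds z \<times>\<^sub>F at_right (0::real))"
    by (rule filterlim_compose[OF tendsto_ident_at filterlim_snd])
  have u0: "((\<lambda>x. fst x) \<longlongrightarrow> z) (nhds z \<times>\<^sub>F at_right (0::real))"
    by (rule filterlim_fst)
  have a: "((\<lambda>x. fst x + snd x *\<^sub>R v) \<longlongrightarrow> z) (nhds z \<times>\<^sub>F at_right (0::real))"
    using tendsto_add[OF u0 tendsto_scaleR[OF t0 tendsto_const[of v]]] by simp
  have pos: "\<forall>\<^sub>F x in nhds z \<times>\<^sub>F at_right (0::real). snd x > 0"
    by (rule eventually_compose_filterlim[OF eventually_at_right_less filterlim_snd])
  have "((\<lambda>x. c * snd x) \<longlongrightarrow> 0) (nhds z \<times>\<^sub>F at_right (0::real))"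
    using tendsto_mult[OF tendsto_const[of c] t0] by simp
  then have b: "filterlim (\<lambda>x. c * snd x) (at_right 0) (nhds z \<times>\<^sub>F at_right (0::real))"
    unfolding filterlim_at using pos assms by (auto elim!: eventually_mono)
  show ?thesis
    by (rule filterlim_Pair[OF a b])
qed

text \<open>Replaces the extended-real upper limit by eventual inequalities between reals, which can
  be added and scaled.\<close>

lemma clarke_dd_le_iff:
  "clarke_dd \<psi> z w \<le> ereal c \<longleftrightarrow>
     (\<forall>e>0. \<forall>\<^sub>F (u, t) in nhds z \<times>\<^sub>F at_right 0. (\<psi> (u + t *\<^sub>R w) - \<psi> u) / t < c + e)"
  (is "?l \<longleftrightarrow> ?r")
proof
  assume ?l
  show ?r
  proof (intro allI impI)
    fix e :: real assume "e > 0"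
    then have "ereal (c + e) > ereal c" by simp
    with \<open>?l\<close> have "\<forall>\<^sub>F x in nhds z \<times>\<^sub>F at_right 0.
        (case x of (u, t) \<Rightarrow> ereal ((\<psi> (u + t *\<^sub>R w) - \<psi> u) / t)) < ereal (c + e)"
      unfolding clarke_dd_def Limsup_le_iff by blast
    then show "\<forall>\<^sub>F (u, t) in nhds z \<times>\<^sub>F at_right 0. (\<psi> (u + t *\<^sub>R w) - \<psi> u) / t < c + e"
      by (rule eventually_mono) auto
  qed
next
  assume r: ?r
  show ?l
    unfolding clarke_dd_def Limsup_le_iff
  proof (intro allI impI)
    fix y assume "ereal c < y"
    then obtain d where d: "c < d" "ereal d < y"
      using ereal_dense2[of "ereal c" y] by auto
    with r[rule_format, of "d - c"] have "\<forall>\<^sub>F (u, t) in nhds z \<times>\<^sub>F at_right 0. (\<psi> (u + t *\<^sub>R w) - \<psi> u) / t < c + (d - c)"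
      by simp
    then show "\<forall>\<^sub>F x in nhds z \<times>\<^sub>F at_right 0.
        (case x of (u, t) \<Rightarrow> ereal ((\<psi> (u + t *\<^sub>R w) - \<psi> u) / t)) < y"
      by (rule eventually_mono) (use d in \<open>auto intro: less_trans[of _ "ereal d"]\<close>)
  qed
qed

lemma clarke_base_neq_bot: "nhds z \<times>\<^sub>F at_right (0::real) \<noteq> bot"
  by (simp add: prod_filter_eq_bot)

text \<open>A Lipschitz constant near \<open>z\<close> bounds all nearby quotients from both sides.
  One \<open>L\<close> serves every direction, which later gives finiteness, continuity in
  \<open>w\<close> and boundedness of the gradient.\<close>

lemma clarke_dd_bounds:
  assumes "loc_lipschitz \<psi>"
  obtains L where "\<And>w. clarke_dd \<psi> z w \<le> ereal (L * norm w)"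
    and "\<And>w. ereal (- (L * norm w)) \<le> clarke_dd \<psi> z w"
proof -
  obtain U L where U: "open U" "z \<in> U" "L > 0"
    and L: "\<And>u v. u \<in> U \<Longrightarrow> v \<in> U \<Longrightarrow> \<bar>\<psi> u - \<psi> v\<bar> \<le> L * norm (u - v)"
    using assms unfolding loc_lipschitz_def by metis
  have ev: "\<forall>\<^sub>F (u, t) in nhds z \<times>\<^sub>F at_right 0. \<bar>(\<psi> (u + t *\<^sub>R w) - \<psi> u) / t\<bar> \<le> L * norm w" for w
  proof -
    have inU: "\<forall>\<^sub>F x in nhds z \<times>\<^sub>F at_right (0::real). fst x \<in> U \<and> snd x > 0"
      by (intro eventually_conj eventually_compose_filterlim[OF eventually_nhds_in_open[OF U(1,2)] filterlim_fst]
          eventually_compose_filterlim[OF eventually_at_right_less filterlim_snd])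
    \<comment> \<open>The endpoint \<open>u + t *\<^sub>R w\<close> must lie in \<open>U\<close> as
      well as the base point.\<close>
    from eventually_compose_filterlim[OF this filterlim_clarke_base[of 1 w z]] have "\<forall>\<^sub>F x in nhds z \<times>\<^sub>F at_right (0::real). fst x + snd x *\<^sub>R w \<in> U \<and> 1 * snd x > 0"
      by simp
    with inU show ?thesis
    proof eventually_elim
      case (elim x)
      obtain u t where x: "x = (u, t)" by (cases x)
      have "\<bar>\<psi> (u + t *\<^sub>R w) - \<psi> u\<bar> \<le> L * norm w * t"
        using L[of "u + t *\<^sub>R w" u] elim by (simp add: x mult_ac)
      then show ?case
        using elim by (simp add: x abs_divide divide_le_eq)
    qed
  qed
  show ?thesis
  proof
    fix w
    show "clarke_dd \<psi> z w \<le> ereal (L * norm w)"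
      unfolding clarke_dd_le_iff
      by (intro allI impI eventually_mono[OF ev[of w]]) (auto simp del: abs_divide)
    show "ereal (- (L * norm w)) \<le> clarke_dd \<psi> z w"
      unfolding clarke_dd_def
      by (intro le_Limsup clarke_base_neq_bot eventually_mono[OF ev[of w]])
        (auto simp del: abs_divide)
  qed
qed

text \<open>The quotient along \<open>v + w\<close> at \<open>u\<close> is the quotient along
  \<open>v\<close> at \<open>u\<close> plus the quotient along \<open>w\<close> at
  \<open>u + t *\<^sub>R v\<close>. The upper limit over all base points near \<open>z\<close>
  absorbs this shift.\<close>

lemma clarke_dd_add_le:
  assumes "clarke_dd \<psi> z v \<le> ereal a" "clarke_dd \<psi> z w \<le> ereal b"
  shows "clarke_dd \<psi> z (v + w) \<le> ereal (a + b)"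
  unfolding clarke_dd_le_iff
proof (intro allI impI)
  fix e :: real assume "e > 0"
  then have e: "e / 2 > 0" by simp
  have 1: "\<forall>\<^sub>F x in nhds z \<times>\<^sub>F at_right 0.
      (\<psi> (fst x + snd x *\<^sub>R v) - \<psi> (fst x)) / snd x < a + e / 2"
    using assms(1) e unfolding clarke_dd_le_iff by (simp add: case_prod_beta')
  have "\<forall>\<^sub>F x in nhds z \<times>\<^sub>F at_right 0.
      (\<psi> (fst x + snd x *\<^sub>R w) - \<psi> (fst x)) / snd x < b + e / 2"
    using assms(2) e unfolding clarke_dd_le_iff by (simp add: case_prod_beta')
  from eventually_compose_filterlim[OF this filterlim_clarke_base[of 1 v z]] have 2: "\<forall>\<^sub>F x in nhds z \<times>\<^sub>F at_right 0.
      (\<psi> (fst x + snd x *\<^sub>R v + snd x *\<^sub>R w) - \<psi> (fst x + snd x *\<^sub>R v)) / snd x < b + e / 2"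
    by simp
  from 1 2 show "\<forall>\<^sub>F (u, t) in nhds z \<times>\<^sub>F at_right 0.
      (\<psi> (u + t *\<^sub>R (v + w)) - \<psi> u) / t < a + b + e"
  proof eventually_elim
    case (elim x)
    then show ?case
      by (simp add: case_prod_beta' scaleR_add_right add.assoc diff_divide_distrib)
  qed
qed

text \<open>A step \<open>t\<close> along \<open>c *\<^sub>R v\<close> is a step
  \<open>c * t\<close> along \<open>v\<close>, so the quotient is multiplied by
  \<open>c\<close>.\<close>

lemma clarke_dd_scale_le:
  assumes "clarke_dd \<psi> z v \<le> ereal a" "c > 0"
  shows "clarke_dd \<psi> z (c *\<^sub>R v) \<le> ereal (c * a)"
  unfolding clarke_dd_le_iff
proof (intro allI impI)
  fix e :: real assume "e > 0"
  then have e: "e / c > 0" using assms(2) by simp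
  have "\<forall>\<^sub>F x in nhds z \<times>\<^sub>F at_right 0.
      (\<psi> (fst x + snd x *\<^sub>R v) - \<psi> (fst x)) / snd x < a + e / c"
    using assms(1) e unfolding clarke_dd_le_iff by (simp add: case_prod_beta')
  from eventually_compose_filterlim[OF this filterlim_clarke_base[OF assms(2), of 0 z]]
  have "\<forall>\<^sub>F x in nhds z \<times>\<^sub>F at_right 0.
      (\<psi> (fst x + (c * snd x) *\<^sub>R v) - \<psi> (fst x)) / (c * snd x) < a + e / c"
    by simp
  then show "\<forall>\<^sub>F (u, t) in nhds z \<times>\<^sub>F at_right 0.
      (\<psi> (u + t *\<^sub>R (c *\<^sub>R v)) - \<psi> u) / t < c * a + e"
  proof eventually_elim
    case (elim x)
    then have "c * ((\<psi> (fst x + (c * snd x) *\<^sub>R v) - \<psi> (fst x)) / (c * snd x)) < c * (a + e / c)"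
      using assms(2) by (intro mult_strict_left_mono)
    then show ?case
      using assms(2) by (simp add: case_prod_beta' distrib_left mult.commute[of _ c])
  qed
qed

section \<open>Clarke gradient: convexity, compactness, support function\<close>

lemma convex_clarke_grad: "convex (clarke_grad \<psi> z)"
proof -
  have "clarke_grad \<psi> z = (\<Inter>w. {x. ereal (x \<bullet> w) \<le> clarke_dd \<psi> z w})"
    by (auto simp: clarke_grad_def)
  moreover have "convex {x. ereal (x \<bullet> w) \<le> clarke_dd \<psi> z w}" for w
    \<comment> \<open>A finite value gives a half-space, an infinite one the whole space or the
      empty set.\<close>
    by (cases "clarke_dd \<psi> z w") (auto simp: inner_commute[of _ w] convex_halfspace_le)
  ultimately show ?thesis by (auto intro!: convex_INT)
qed

lemma compact_clarke_grad:
  fixes \<psi> :: "real ^ 'n \<Rightarrow> real"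
  assumes "loc_lipschitz \<psi>"
  shows "compact (clarke_grad \<psi> z)"
proof -
  have "clarke_grad \<psi> z = (\<Inter>w. {x. ereal (x \<bullet> w) \<le> clarke_dd \<psi> z w})"
    by (auto simp: clarke_grad_def)
  moreover have "closed {x. ereal (x \<bullet> w) \<le> clarke_dd \<psi> z w}" for w
    by (cases "clarke_dd \<psi> z w") (auto simp: inner_commute[of _ w] closed_halfspace_le)
  ultimately have cl: "closed (clarke_grad \<psi> z)" by auto
  obtain L where L: "\<And>w. clarke_dd \<psi> z w \<le> ereal (L * norm w)"
    using clarke_dd_bounds[OF assms] by metis
  have "norm x \<le> L" if "x \<in> clarke_grad \<psi> z" for x :: "real ^ 'n"
  proof (cases "x = 0")
    case True
    \<comment> \<open>The sign of \<open>L\<close> is not recorded in its defining bounds; testing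
      with a unit vector gives \<open>0 \<le> L\<close>.\<close>
    have "ereal (x \<bullet> axis undefined 1) \<le> clarke_dd \<psi> z (axis undefined 1)"
      using that unfolding clarke_grad_def by blast
    from order_trans[OF this L] True show ?thesis by simp
  next
    case False
    \<comment> \<open>Testing \<open>x\<close> against itself gives
      \<open>norm x ^ 2 \<le> L * norm x\<close>.\<close>
    have "ereal (x \<bullet> x) \<le> ereal (L * norm x)"
      using that L[of x] order_trans unfolding clarke_grad_def by blast
    with False show ?thesis by (simp add: dot_square_norm power2_eq_square)
  qed
  then have "bounded (clarke_grad \<psi> z)" by (auto simp: bounded_iff)
  with cl show ?thesis by (simp add: compact_eq_bounded_closed)
qed

text \<open>A Hahn-Banach argument: the real-valued derivative \<open>d\<close> is sublinear and
  continuous, so its epigraph \<open>K\<close> is a closed convex cone. A hyperplane separating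
  \<open>(w, c)\<close> from \<open>K\<close> is the graph of a linear function below
  \<open>d\<close>, once moved to the origin.\<close>

lemma clarke_grad_approximates_clarke_dd:
  fixes \<psi> :: "real ^ 'n \<Rightarrow> real"
  assumes "loc_lipschitz \<psi>" "ereal c < clarke_dd \<psi> z w"
  obtains x where "x \<in> clarke_grad \<psi> z" "x \<bullet> w > c"
proof -
  obtain L where L: "\<And>w. clarke_dd \<psi> z w \<le> ereal (L * norm w)"
    and L': "\<And>w. ereal (- (L * norm w)) \<le> clarke_dd \<psi> z w"
    using clarke_dd_bounds[OF assms(1)] by metis
  define d where "d w = real_of_ereal (clarke_dd \<psi> z w)" for w
  have d: "clarke_dd \<psi> z w = ereal (d w)" for w
    using L[of w] L'[of w] by (cases "clarke_dd \<psi> z w") (auto simp: d_def)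
  have add: "d (v + w) \<le> d v + d w" for v w
    using clarke_dd_add_le[of \<psi> z v "d v" w "d w"] by (simp add: d)
  have scale: "d (c *\<^sub>R v) \<le> c * d v" if "c > 0" for c v
    using clarke_dd_scale_le[of \<psi> z v "d v" c] that by (simp add: d)
  have d0: "d 0 = 0"
    using L[of 0] L'[of 0] by (simp add: d)
  have scale0: "d (c *\<^sub>R v) \<le> c * d v" if "c \<ge> 0" for c v
    using scale[of c v] that d0 by (cases "c = 0") auto
  have lip: "d v \<le> d w + L * dist v w" for v w
    using add[of w "v - w"] L[of "v - w"] by (simp add: d dist_norm)
  have "(abs L)-lipschitz_on UNIV d"
  proof (rule lipschitz_onI)
    fix x y :: "real^'n"
    have "L * dist x y \<le> \<bar>L\<bar> * dist x y" by (intro mult_right_mono) auto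
    with lip[of x y] lip[of y x] show "dist (d x) (d y) \<le> \<bar>L\<bar> * dist x y"
      by (simp add: dist_commute[of y] dist_real_def)
  qed auto
  then have cont: "continuous_on UNIV d"
    by (rule lipschitz_on_continuous_on)
  define K where "K = {x :: (real ^ 'n) \<times> real. d (fst x) \<le> snd x}"
  have "continuous_on UNIV (\<lambda>x :: (real ^ 'n) \<times> real. d (fst x))"
    by (rule continuous_on_compose2[OF cont]) (auto intro: continuous_intros)
  then have "closed K"
    unfolding K_def by (intro closed_Collect_le continuous_intros)
  moreover have "convex K"
  proof (rule convexI)
    fix x y :: "(real ^ 'n) \<times> real" and s t :: real
    assume A: "x \<in> K" "y \<in> K" "0 \<le> s" "0 \<le> t" "s + t = 1"
    have "d (s *\<^sub>R fst x + t *\<^sub>R fst y) \<le> s * d (fst x) + t * d (fst y)"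
      using add[of "s *\<^sub>R fst x" "t *\<^sub>R fst y"] scale0 A(3,4) by (smt (verit))
    also have "\<dots> \<le> s * snd x + t * snd y"
      using A by (intro add_mono mult_left_mono) (auto simp: K_def)
    finally show "s *\<^sub>R x + t *\<^sub>R y \<in> K" by (simp add: K_def)
  qed
  moreover have "(w, c) \<notin> K"
    using assms(2) by (simp add: K_def d)
  ultimately obtain a b where ab: "a \<bullet> (w, c) < b" "\<And>x. x \<in> K \<Longrightarrow> a \<bullet> x > b"
    using separating_hyperplane_closed_point[of K "(w, c)"] by blast
  obtain a1 a2 where a: "a = (a1, a2)" by (cases a)
  have "b < 0" using ab(2)[of 0] d0 by (simp add: K_def)
  \<comment> \<open>\<open>K\<close> is a cone: a point with negative value could be scaled by
    \<open>s > 0\<close> onto the hyperplane \<open>a \<bullet> x = b\<close>, which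
    \<open>K\<close> does not meet.\<close>
  have nonneg: "a \<bullet> x \<ge> 0" if "x \<in> K" for x
  proof (rule ccontr)
    assume neg: "\<not> a \<bullet> x \<ge> 0"
    define s where "s = b / (a \<bullet> x)"
    have "s > 0" using neg \<open>b < 0\<close> by (simp add: s_def divide_neg_neg)
    then have "d (s *\<^sub>R fst x) \<le> s * d (fst x)" by (rule scale)
    also have "\<dots> \<le> s * snd x"
      using that \<open>s > 0\<close> by (intro mult_left_mono) (auto simp: K_def)
    finally have "d (s *\<^sub>R fst x) \<le> s * snd x" .
    then have "s *\<^sub>R x \<in> K" by (simp add: K_def)
    from ab(2)[OF this] neg show False by (simp add: s_def)
  qed
  \<comment> \<open>Comparing \<open>(w, d w)\<close> in \<open>K\<close> with \<open>(w, c)\<close>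
    below it shows that the hyperplane is not vertical, so its normal can be divided by
    \<open>a2\<close>.\<close>
  have "a1 \<bullet> w + a2 * d w \<ge> 0"
    using nonneg[of "(w, d w)"] by (simp add: K_def a)
  moreover have "a1 \<bullet> w + a2 * c < 0"
    using ab(1) \<open>b < 0\<close> by (simp add: a)
  ultimately have "a2 * (d w - c) > 0" by (simp add: algebra_simps)
  moreover have "d w - c > 0" using assms(2) by (simp add: d)
  ultimately have a2: "a2 > 0" by (simp add: zero_less_mult_iff)
  show ?thesis
  proof
    show "(- (1 / a2)) *\<^sub>R a1 \<in> clarke_grad \<psi> z"
      unfolding clarke_grad_def
    proof (intro CollectI allI)
      fix v
      have "a1 \<bullet> v + a2 * d v \<ge> 0"
        using nonneg[of "(v, d v)"] by (simp add: K_def a)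
      then show "ereal ((- (1 / a2)) *\<^sub>R a1 \<bullet> v) \<le> clarke_dd \<psi> z v"
        using a2 by (simp add: d field_simps)
    qed
    show "(- (1 / a2)) *\<^sub>R a1 \<bullet> w > c"
      using \<open>a1 \<bullet> w + a2 * c < 0\<close> a2 by (simp add: field_simps)
  qed
qed

text \<open>In direction 0 the derivative is at least 0, so the level \<open>- 1\<close> lies
  strictly below it and is exceeded by some gradient element.\<close>

lemma clarke_grad_nonempty:
  fixes \<psi> :: "real ^ 'n \<Rightarrow> real"
  assumes "loc_lipschitz \<psi>"
  shows "clarke_grad \<psi> z \<noteq> {}"
proof -
  obtain L where L: "\<And>w. ereal (- (L * norm w)) \<le> clarke_dd \<psi> z w"
    using clarke_dd_bounds[OF assms] by metis
  have "ereal (- 1) < ereal (- (L * norm (0 :: real ^ 'n)))" by simp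
  also note L[of 0]
  finally have "ereal (- 1) < clarke_dd \<psi> z 0" .
  then show ?thesis
    using clarke_grad_approximates_clarke_dd[OF assms] by blast
qed

section \<open>Descent directions and a Fritz John rule\<close>

text \<open>The base point filter is \<open>nhds z\<close>, so the eventually negative quotients
  include those taken at \<open>u = z\<close> itself.\<close>

lemma clarke_dd_neg_imp_descent:
  assumes "clarke_dd \<psi> z w < 0"
  shows "\<forall>\<^sub>F t in at_right 0. \<psi> (z + t *\<^sub>R w) < \<psi> z"
proof -
  have "\<forall>\<^sub>F x in nhds z \<times>\<^sub>F at_right 0.
      (case x of (u, t) \<Rightarrow> ereal ((\<psi> (u + t *\<^sub>R w) - \<psi> u) / t)) < 0"
    using assms unfolding clarke_dd_def by (intro Limsup_lessD)
  then obtain P Q where P: "eventually P (nhds z)" and Q: "eventually Q (at_right (0::real))"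
    and PQ: "\<And>u t. P u \<Longrightarrow> Q t \<Longrightarrow> (\<psi> (u + t *\<^sub>R w) - \<psi> u) / t < 0"
    unfolding eventually_prod_filter by auto
  from P have "P z" by (rule eventually_nhds_x_imp_x)
  from Q eventually_at_right_less[of "0::real"] show ?thesis
  proof eventually_elim
    case (elim t)
    with PQ[OF \<open>P z\<close>, of t] show ?case by (auto simp: divide_less_0_iff)
  qed
qed

lemma fritz_john_clarke:
  fixes \<phi> :: "'i \<Rightarrow> real ^ 'n \<Rightarrow> real"
  assumes "finite I" "I \<noteq> {}" and lip: "\<And>i. i \<in> I \<Longrightarrow> loc_lipschitz (\<phi> i)"
    and min: "\<forall>\<^sub>F x in nhds z. \<exists>i\<in>I. \<phi> i x \<ge> \<phi> i z"
  obtains c s where "\<And>i. i \<in> I \<Longrightarrow> c i \<ge> 0" "sum c I = 1"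
    "\<And>i. i \<in> I \<Longrightarrow> s i \<in> clarke_grad (\<phi> i) z" "(\<Sum>i\<in>I. c i *\<^sub>R s i) = 0"
proof -
  define H where "H = convex hull (\<Union>i\<in>I. clarke_grad (\<phi> i) z)"
  have "0 \<in> H"
  proof (rule ccontr)
    assume "0 \<notin> H"
    have "compact (\<Union>i\<in>I. clarke_grad (\<phi> i) z)"
      using assms(1) lip by (intro compact_UN) (auto intro: compact_clarke_grad)
    then have "closed H"
      unfolding H_def by (intro compact_imp_closed compact_convex_hull)
    moreover have "convex H" by (simp add: H_def)
    ultimately obtain a b where ab: "a \<bullet> 0 < b" "\<And>x. x \<in> H \<Longrightarrow> a \<bullet> x > b"
      using separating_hyperplane_closed_point[of H 0] \<open>0 \<notin> H\<close> by blast
    \<comment> \<open>On \<open>H\<close> the pairing with \<open>- a\<close> stays below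
      \<open>- b < 0\<close>. This uniform gap matters: a derivative \<open>\<ge> 0\<close> only
      yields gradient elements above a level strictly below it, here \<open>- b\<close>.\<close>
    have "clarke_dd (\<phi> i) z (- a) < 0" if i: "i \<in> I" for i
    proof (rule ccontr)
      assume "\<not> clarke_dd (\<phi> i) z (- a) < 0"
      then have "0 \<le> clarke_dd (\<phi> i) z (- a)" by simp
      moreover have "ereal (- b) < 0" using ab(1) by simp
      ultimately have "ereal (- b) < clarke_dd (\<phi> i) z (- a)" by (rule less_le_trans[rotated])
      then obtain x where x: "x \<in> clarke_grad (\<phi> i) z" "x \<bullet> (- a) > - b"
        using clarke_grad_approximates_clarke_dd[OF lip[OF i]] by blast
      from x(1) i have "x \<in> H" unfolding H_def by (auto intro: hull_inc)
      from ab(2)[OF this] x(2) show False by (simp add: inner_commute)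
    qed
    then have "\<forall>\<^sub>F t in at_right 0. \<forall>i\<in>I. \<phi> i (z + t *\<^sub>R (- a)) < \<phi> i z"
      using assms(1) by (intro eventually_ball_finite) (blast intro: clarke_dd_neg_imp_descent)+
    moreover have "\<forall>\<^sub>F t in at_right 0. \<exists>i\<in>I. \<phi> i (z + t *\<^sub>R (- a)) \<ge> \<phi> i z"
    proof -
      have "((\<lambda>t::real. z + t *\<^sub>R (- a)) \<longlongrightarrow> z + 0 *\<^sub>R (- a)) (at_right 0)"
        by (intro tendsto_intros)
      then have "filterlim (\<lambda>t::real. z + t *\<^sub>R (- a)) (nhds z) (at_right 0)" by simp
      with min show ?thesis unfolding filterlim_iff by blast
    qed
    ultimately have "\<forall>\<^sub>F t in at_right (0::real). False"
      by eventually_elim (auto simp: not_less[symmetric])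
    then show False by simp
  qed
  \<comment> \<open>Since each gradient is convex and nonempty, one representative
    \<open>s i\<close> per index suffices, also where \<open>c i = 0\<close>.\<close>
  then have "0 \<in> {\<Sum>i\<in>I. c i *\<^sub>R s i |c s. (\<forall>i\<in>I. c i \<ge> 0) \<and> sum c I = 1 \<and>
      (\<forall>i\<in>I. s i \<in> clarke_grad (\<phi> i) z)}"
    unfolding H_def using assms(1) lip
    by (subst (asm) convex_hull_finite_union) (auto intro: convex_clarke_grad simp: clarke_grad_nonempty)
  then show ?thesis using that by (smt (verit) mem_Collect_eq)
qed

section \<open>Center and half-width functions, continuity, merging of weights\<close>

lemma loc_lipschitz_center_halfwidth:
  assumes "iv_loc_lipschitz f"
  shows "loc_lipschitz (\<lambda>x. center (f x))" "loc_lipschitz (\<lambda>x. halfwidth (f x))"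
proof -
  have "\<exists>U L. open U \<and> u \<in> U \<and> L > 0 \<and> (\<forall>u1\<in>U. \<forall>u2\<in>U.
      \<bar>center (f u1) - center (f u2)\<bar> \<le> L * norm (u1 - u2) \<and>
      \<bar>halfwidth (f u1) - halfwidth (f u2)\<bar> \<le> L * norm (u1 - u2))" for u
  proof -
    obtain U L where "open U" "u \<in> U" "L > 0" "\<And>u1 u2. u1 \<in> U \<Longrightarrow> u2 \<in> U \<Longrightarrow>
        max \<bar>lower (f u1) - lower (f u2)\<bar> \<bar>upper (f u1) - upper (f u2)\<bar> \<le> L * norm (u1 - u2)"
      using assms unfolding iv_loc_lipschitz_def by metis
    then show ?thesis
      unfolding center_def halfwidth_def
      by (intro exI[of _ U] exI[of _ L]) (fastforce simp: field_simps abs_if split: if_splits)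
  qed
  then show "loc_lipschitz (\<lambda>x. center (f x))" "loc_lipschitz (\<lambda>x. halfwidth (f x))"
    unfolding loc_lipschitz_def by meson+
qed

lemma loc_lipschitz_imp_isCont:
  assumes "loc_lipschitz \<psi>"
  shows "isCont \<psi> z"
proof -
  obtain U L where U: "open U" "z \<in> U" "L > 0"
    and L: "\<And>u v. u \<in> U \<Longrightarrow> v \<in> U \<Longrightarrow> \<bar>\<psi> u - \<psi> v\<bar> \<le> L * norm (u - v)"
    using assms unfolding loc_lipschitz_def by metis
  then have "L-lipschitz_on U \<psi>"
    by (intro lipschitz_onI) (auto simp: dist_norm)
  with U show ?thesis
    using continuous_on_eq_continuous_at lipschitz_on_continuous_on by blast
qed

text \<open>Normalizing the two weights merges the center and half-width terms of one objective into
  a multiple of a single element of its weakly generalized gradient.\<close>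

lemma scaled_sum_mem_convex_hull:
  assumes "x \<in> A" "y \<in> B" "a \<ge> 0" "b \<ge> (0::real)"
  shows "a *\<^sub>R x + b *\<^sub>R y \<in> (*\<^sub>R) (a + b) ` (convex hull (A \<union> B))"
proof (cases "a + b = 0")
  case True
  then have "a = 0" "b = 0" using assms by auto
  then show ?thesis using assms(1) by (auto intro!: image_eqI[of _ _ x] hull_inc)
next
  case False
  then have p: "a + b > 0" using assms by auto
  have "(a / (a + b)) *\<^sub>R x + (b / (a + b)) *\<^sub>R y \<in> convex hull (A \<union> B)"
    using assms p by (intro convexD[OF convex_convex_hull])
      (auto intro: hull_inc simp flip: add_divide_distrib)
  moreover have "a *\<^sub>R x + b *\<^sub>R y = (a + b) *\<^sub>R ((a / (a + b)) *\<^sub>R x + (b / (a + b)) *\<^sub>R y)"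
    using False by (simp add: scaleR_add_right)
  ultimately show ?thesis by (rule rev_image_eqI)
qed

section \<open>Multipliers under BCQ\<close>

theorem theorem4p2:
  fixes F :: "nat \<Rightarrow> real ^ 'n \<Rightarrow> real interval"
    and g :: "nat \<Rightarrow> real ^ 'n \<Rightarrow> real"
    and m p :: nat
    and ubar :: "real ^ 'n"
  assumes "\<And>k. k \<in> {1..m} \<Longrightarrow> iv_loc_lipschitz (F k)"
    and "\<And>j. j \<in> {1..p} \<Longrightarrow> loc_lipschitz (g j)"
    and "ubar \<in> weak_minimal m F (feasible_set p g)"
    and "BCQ p g ubar"
  shows "\<exists>lam\<in>nonneg_orthant m. \<exists>\<mu>\<in>nonneg_orthant p.
           (\<Sum>k\<in>{1..m}. lam k) = 1 \<and>
           0 \<in> (\<Sum>k\<in>{1..m}. (*\<^sub>R) (lam k) ` weak_gen_grad (F k) ubar)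
               + (\<Sum>j\<in>active p g ubar. (*\<^sub>R) (\<mu> j) ` clarke_grad (g j) ubar) \<and>
           (\<forall>j\<in>{1..p}. \<mu> j * g j ubar = 0)"
proof -
  define A where "A = active p g ubar"
  have A: "finite A" "A \<subseteq> {1..p}" "\<And>j. j \<in> A \<Longrightarrow> g j ubar = 0"
    by (auto simp: A_def active_def)
  have feas: "\<And>j. j \<in> {1..p} \<Longrightarrow> g j ubar \<le> 0"
    and opt: "\<And>z. (\<And>j. j \<in> {1..p} \<Longrightarrow> g j z \<le> 0) \<Longrightarrow> \<exists>k\<in>{1..m}. \<not> F k z \<prec>\<^sub>C\<^sub>W F k ubar"
    using assms(3) unfolding weak_minimal_def feasible_set_def by blast+
  \<comment> \<open>Indices for centers, half-widths and active constraints. Inactive constraints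
    stay negative near \<open>ubar\<close> by continuity, so they are left out.\<close>
  define I where "I = {1..m} <+> ({1..m} <+> A)"
  have I_iff: "Inl k \<in> I \<longleftrightarrow> k \<in> {1..m}" "Inr (Inl k) \<in> I \<longleftrightarrow> k \<in> {1..m}"
    "Inr (Inr j) \<in> I \<longleftrightarrow> j \<in> A" for k j
    by (auto simp: I_def)
  define \<phi> where "\<phi> = case_sum (\<lambda>k x. center (F k x)) (case_sum (\<lambda>k x. halfwidth (F k x)) g)"
  have "finite I" by (simp add: I_def A)
  \<comment> \<open>Applying \<open>opt\<close> to the feasible point \<open>ubar\<close> itself
    produces an index in \<open>{1..m}\<close>, so \<open>m > 0\<close>.\<close>
  have "I \<noteq> {}" using opt[of ubar] feas by (fastforce simp: I_def)
  have lip: "loc_lipschitz (\<phi> i)" if "i \<in> I" for i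
    using that assms(1,2) A(2) unfolding I_def \<phi>_def
    by (auto intro!: loc_lipschitz_center_halfwidth)
  have "\<forall>\<^sub>F x in nhds ubar. \<forall>j\<in>{1..p} - A. g j x < 0"
  proof (intro eventually_ball_finite ballI)
    fix j assume j: "j \<in> {1..p} - A"
    then have "g j ubar < 0" using feas[of j] by (auto simp: A_def active_def)
    moreover have "(g j \<longlongrightarrow> g j ubar) (nhds ubar)"
      using loc_lipschitz_imp_isCont[OF assms(2), of j ubar] j
      unfolding isCont_def tendsto_nhds_iff by auto
    ultimately show "\<forall>\<^sub>F x in nhds ubar. g j x < 0"
      using order_tendstoD(2) by blast
  qed simp
  \<comment> \<open>A nearby point lowering every \<open>\<phi> i\<close> would be feasible, with
    active constraints falling below 0, and would improve the center and half-width of every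
    objective.\<close>
  then have min: "\<forall>\<^sub>F x in nhds ubar. \<exists>i\<in>I. \<phi> i x \<ge> \<phi> i ubar"
  proof eventually_elim
    case (elim x)
    show ?case
    proof (rule ccontr)
      assume "\<not> ?thesis"
      then have lt: "\<And>i. i \<in> I \<Longrightarrow> \<phi> i x < \<phi> i ubar" by (auto simp: not_le)
      have "g j x \<le> 0" if "j \<in> {1..p}" for j
      proof (cases "j \<in> A")
        case True
        then show ?thesis using lt[of "Inr (Inr j)"] A(3)[of j] by (simp add: I_iff \<phi>_def)
      qed (use elim that in force)
      with opt obtain k where k: "k \<in> {1..m}" "\<not> F k x \<prec>\<^sub>C\<^sub>W F k ubar" by blast
      then show False
        using lt[of "Inl k"] lt[of "Inr (Inl k)"] by (auto simp: I_iff \<phi>_def prec_CW_def)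
    qed
  qed
  obtain c s where c: "\<And>i. i \<in> I \<Longrightarrow> c i \<ge> 0" "sum c I = 1"
    and s: "\<And>i. i \<in> I \<Longrightarrow> s i \<in> clarke_grad (\<phi> i) ubar" and cs: "(\<Sum>i\<in>I. c i *\<^sub>R s i) = 0"
    using fritz_john_clarke[OF \<open>finite I\<close> \<open>I \<noteq> {}\<close> lip min] by metis
  define \<alpha> where "\<alpha> k = c (Inl k) + c (Inr (Inl k))" for k
  \<comment> \<open>Extended by 0 off \<open>A\<close>, as BCQ quantifies over all of
    \<open>{1..p}\<close>.\<close>
  define \<nu> where "\<nu> j = (if j \<in> A then c (Inr (Inr j)) else 0)" for j
  define x where "x k = c (Inl k) *\<^sub>R s (Inl k) + c (Inr (Inl k)) *\<^sub>R s (Inr (Inl k))" for k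
  define T where "T = (\<Sum>k\<in>{1..m}. \<alpha> k)"
  have \<alpha>0: "\<alpha> k \<ge> 0" if "k \<in> {1..m}" for k
    unfolding \<alpha>_def using that by (intro add_nonneg_nonneg c) (auto simp: I_iff)
  have \<nu>0: "\<nu> j \<ge> 0" for j
    unfolding \<nu>_def by (auto intro!: c simp: I_iff)
  have sg: "s (Inr (Inr j)) \<in> clarke_grad (g j) ubar" if "j \<in> A" for j
    using s[of "Inr (Inr j)"] that by (simp add: I_iff \<phi>_def)
  have x: "x k \<in> (*\<^sub>R) (\<alpha> k) ` weak_gen_grad (F k) ubar" if "k \<in> {1..m}" for k
    unfolding x_def \<alpha>_def weak_gen_grad_def
    using s[of "Inl k"] s[of "Inr (Inl k)"] that
    by (intro scaled_sum_mem_convex_hull c) (auto simp: I_iff \<phi>_def)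
  have sumT: "T + (\<Sum>j\<in>A. \<nu> j) = 1"
    using c(2) A(1) by (simp add: I_def sum.Plus T_def \<alpha>_def \<nu>_def sum.distrib add.assoc)
  have sum0: "(\<Sum>k\<in>{1..m}. x k) + (\<Sum>j\<in>A. \<nu> j *\<^sub>R s (Inr (Inr j))) = 0"
    using cs A(1) by (simp add: I_def sum.Plus x_def \<nu>_def sum.distrib add.assoc)
  \<comment> \<open>With \<open>T = 0\<close> all objective terms \<open>x k\<close> vanish; the
    constraint terms then sum to 0 with weights of total 1, which BCQ forbids.\<close>
  have "T \<noteq> 0"
  proof
    assume "T = 0"
    then have "\<alpha> k = 0" if "k \<in> {1..m}" for k
      using that \<alpha>0 unfolding T_def by (subst (asm) sum_nonneg_eq_0_iff) auto
    then have "x k = 0" if "k \<in> {1..m}" for k using x[OF that] that by auto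
    with sum0 have 0: "(\<Sum>j\<in>A. \<nu> j *\<^sub>R s (Inr (Inr j))) = 0" by simp
    \<comment> \<open>The Minkowski sum in BCQ also runs over inactive indices, where a summand
      \<open>{0}\<close> arises only from a nonempty gradient; hence \<open>r\<close> picks an
      element there too.\<close>
    have "\<exists>r. r \<in> clarke_grad (g j) ubar \<and> (j \<in> A \<longrightarrow> r = s (Inr (Inr j)))" if "j \<in> {1..p}" for j
      using sg[of j] clarke_grad_nonempty[OF assms(2)[OF that], of ubar] by (cases "j \<in> A") auto
    then obtain r where r: "\<And>j. j \<in> {1..p} \<Longrightarrow> r j \<in> clarke_grad (g j) ubar"
        "\<And>j. j \<in> {1..p} \<Longrightarrow> j \<in> A \<Longrightarrow> r j = s (Inr (Inr j))"
      by metis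
    have "(\<Sum>j\<in>{1..p}. \<nu> j *\<^sub>R r j) = (\<Sum>j\<in>A. \<nu> j *\<^sub>R s (Inr (Inr j)))"
      using A r(2) by (intro sum.mono_neutral_cong_right) (auto simp: \<nu>_def)
    with 0 r(1) have mem: "0 \<in> (\<Sum>j\<in>{1..p}. (*\<^sub>R) (\<nu> j) ` clarke_grad (g j) ubar)"
      by (auto simp: set_sum_alt intro!: exI[of _ "\<lambda>j. \<nu> j *\<^sub>R r j"])
    have "\<exists>j\<in>{1..p}. \<nu> j \<noteq> 0"
    proof (rule ccontr)
      assume "\<not> ?thesis"
      then have "(\<Sum>j\<in>A. \<nu> j) = 0" using A(2) by (intro sum.neutral) auto
      with sumT \<open>T = 0\<close> show False by simp
    qed
    moreover have "\<forall>j\<in>{1..p} - A. \<nu> j = 0" by (simp add: \<nu>_def)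
    moreover have "\<nu> \<in> nonneg_orthant p" using \<nu>0 by (simp add: nonneg_orthant_def)
    ultimately show False
      using mem \<nu>0 assms(4) unfolding BCQ_def A_def[symmetric] by blast
  qed
  moreover have "T \<ge> 0" unfolding T_def by (intro sum_nonneg \<alpha>0)
  ultimately have T: "T > 0" by simp
  \<comment> \<open>Dividing all weights by \<open>T\<close> makes the objective weights sum to 1
    and keeps the vanishing combination.\<close>
  show ?thesis
  proof (intro bexI conjI ballI)
    show "(\<lambda>k. \<alpha> k / T) \<in> nonneg_orthant m" "(\<lambda>j. \<nu> j / T) \<in> nonneg_orthant p"
      using \<alpha>0 \<nu>0 T by (auto simp: nonneg_orthant_def)
    show "(\<Sum>k\<in>{1..m}. \<alpha> k / T) = 1"
      using T by (simp add: T_def flip: sum_divide_distrib)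
    show "\<nu> j / T * g j ubar = 0" for j
      using A(3)[of j] by (simp add: \<nu>_def)
    have "(1 / T) *\<^sub>R x k \<in> (*\<^sub>R) (\<alpha> k / T) ` weak_gen_grad (F k) ubar" if "k \<in> {1..m}" for k
      using x[OF that] by auto
    then have "(\<Sum>k\<in>{1..m}. (1 / T) *\<^sub>R x k)
        \<in> (\<Sum>k\<in>{1..m}. (*\<^sub>R) (\<alpha> k / T) ` weak_gen_grad (F k) ubar)"
      by (auto simp: set_sum_alt)
    moreover have "(\<Sum>j\<in>A. (1 / T) *\<^sub>R \<nu> j *\<^sub>R s (Inr (Inr j)))
        \<in> (\<Sum>j\<in>A. (*\<^sub>R) (\<nu> j / T) ` clarke_grad (g j) ubar)"
      using A(1) sg by (auto simp: set_sum_alt intro: exI)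
    ultimately have "(\<Sum>k\<in>{1..m}. (1 / T) *\<^sub>R x k) + (\<Sum>j\<in>A. (1 / T) *\<^sub>R \<nu> j *\<^sub>R s (Inr (Inr j)))
        \<in> (\<Sum>k\<in>{1..m}. (*\<^sub>R) (\<alpha> k / T) ` weak_gen_grad (F k) ubar)
          + (\<Sum>j\<in>A. (*\<^sub>R) (\<nu> j / T) ` clarke_grad (g j) ubar)"
      by (rule set_plus_intro)
    also have "(\<Sum>k\<in>{1..m}. (1 / T) *\<^sub>R x k) + (\<Sum>j\<in>A. (1 / T) *\<^sub>R \<nu> j *\<^sub>R s (Inr (Inr j)))
        = (1 / T) *\<^sub>R ((\<Sum>k\<in>{1..m}. x k) + (\<Sum>j\<in>A. \<nu> j *\<^sub>R s (Inr (Inr j))))"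
      unfolding scaleR_add_right scaleR_sum_right ..
    also have "\<dots> = 0"
      unfolding sum0 by simp
    finally show "0 \<in> (\<Sum>k\<in>{1..m}. (*\<^sub>R) (\<alpha> k / T) ` weak_gen_grad (F k) ubar)
        + (\<Sum>j\<in>active p g ubar. (*\<^sub>R) (\<nu> j / T) ` clarke_grad (g j) ubar)"
      unfolding A_def .
  qed
qed

end
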